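(* Let $d\in\mathbb{N}$, $\varepsilon>0$, $K>0$, $0<\delta\le1$, and let $E_1,E_2:[0,\infty)\to\mathbb{R}$ be as in the context. If $r_0\ge0$ is an optimal choice of the parameter in the error bound $E_1(r_0)+E_2(r_0)$, i.e. $r_0$ minimizes $E_1+E_2$ over $[0,\infty)$, then either $r_0=0$ or $r_0$ satisfies $$\exp\left(\frac{(1+\varepsilon)K}{6\varepsilon}r_0^3\right)-1-\exp\left(\frac{1-\delta}{2\varepsilon}r_0^2\right)=0.$$
   Context: $$E_1(r_0):=c_d\,\varepsilon^{-d/2}\int_0^{r_0}f(r)\,r^{d-1}\,\mathrm{d}r,\qquad E_2(r_0):=\delta^{-d/2}\left(1-\Xi_d\!\left(\frac{\delta r_0^2}{\varepsilon}\right)\right),$$ where $$f(r):=\left[\exp\left(\frac{(1+\varepsilon)K}{6\varepsilon}r^3\right)-1\right]\exp\left(-\frac{1}{2\varepsilon}r^2\right),\qquad c_d:=\frac{2^{1-d/2}}{\Gamma(d/2)},$$ and $\Xi_d(t):=\gamma(\frac d2,\frac t2)/\Gamma(\frac d2)$ for $t\ge0$, with $\gamma(a,z)=\int_0^z s^{a-1}e^{-s}\,\mathrm{d}s$ the lower incomplete gamma function. *)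

theory Defs
  imports "HOL-Analysis.Analysis"
begin

definition lower_gamma :: "real \<Rightarrow> real \<Rightarrow> real" where
  "lower_gamma a z = integral {0..z} (\<lambda>s. s powr (a - 1) * exp (- s))"

(* The distribution function, on t >= 0, of the chi-squared law with d degrees of freedom. *)
definition Xi :: "nat \<Rightarrow> real \<Rightarrow> real" where
  "Xi d t = lower_gamma (real d / 2) (t / 2) / Gamma (real d / 2)"

definition f_E1 :: "real \<Rightarrow> real \<Rightarrow> real \<Rightarrow> real" where
  "f_E1 \<epsilon> K r = (exp ((1 + \<epsilon>) * K / (6 * \<epsilon>) * r ^ 3) - 1) * exp (- (1 / (2 * \<epsilon>)) * r\<^sup>2)"

definition c_dim :: "nat \<Rightarrow> real" where
  "c_dim d = 2 powr (1 - real d / 2) / Gamma (real d / 2)"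

(* The exponent d - 1 is a natural-number subtraction, so these are meant for d >= 1. *)
definition E1 :: "nat \<Rightarrow> real \<Rightarrow> real \<Rightarrow> real \<Rightarrow> real" where
  "E1 d \<epsilon> K r0 = c_dim d * \<epsilon> powr (- (real d / 2)) * integral {0..r0} (\<lambda>r. f_E1 \<epsilon> K r * r ^ (d - 1))"

definition E2 :: "nat \<Rightarrow> real \<Rightarrow> real \<Rightarrow> real \<Rightarrow> real" where
  "E2 d \<epsilon> \<delta> r0 = \<delta> powr (- (real d / 2)) * (1 - Xi d (\<delta> * r0\<^sup>2 / \<epsilon>))"

end

theory Submission
  imports Defs
begin

text \<open>A minimizer \<open>r0 > 0\<close> is interior, so the derivative of
  \<open>E1 + E2\<close> vanishes there. With C =
  \<open>c_dim d * \<epsilon> powr (- (real d / 2))\<close>, the fundamental theorem of calculus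
  gives E1'(r) = C r^(d-1) f(r) (\<open>E1_has_real_derivative\<close>) and, with the chain rule,
  E2'(r) = - C r^(d-1) exp(-\<delta> r^2 / (2 \<epsilon>)) (\<open>E2_has_real_derivative\<close>).
  The normalizations are such that both derivatives carry the same positive factor C r^(d-1).
  Cancelling it leaves f(r0) = exp(-\<delta> r0^2 / (2 \<epsilon>)), and cancelling the Gaussian
  factor of f gives the claimed equation.\<close>

text \<open>The fundamental theorem of calculus at an interior point. Continuity is asked at
  \<open>x\<close> alone because the integrand of \<open>lower_gamma a\<close> is unbounded near 0
  when \<open>a < 1\<close>, that is, for \<open>d = 1\<close>.\<close>

lemma integral_has_real_derivative_at:
  fixes f :: "real \<Rightarrow> real"
  assumes "f integrable_on {a..b}" and "a < x" and "x < b" and "isCont f x"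
  shows "((\<lambda>u. integral {a..u} f) has_real_derivative f x) (at x)"
proof -
  have "((\<lambda>u. integral {a..u} f) has_vector_derivative f x) (at x within {a..b} - {})"
    using assms continuous_at_imp_continuous_at_within
    by (intro integral_has_vector_derivative_continuous_at) auto
  moreover have "at x within {a..b} = at x"
    using assms by (intro at_within_interior) auto
  ultimately show ?thesis
    by (simp add: has_real_derivative_iff_has_vector_derivative)
qed

lemma lower_gamma_has_real_derivative:
  assumes "a > 0" and "z > 0"
  shows "(lower_gamma a has_real_derivative z powr (a - 1) * exp (- z)) (at z)"
proof -
  \<comment> \<open>Integrability across the possible singularity at 0 is inherited from Euler's
    integral for \<open>Gamma a\<close>.\<close>
  have "(\<lambda>s. s powr (a - 1) * exp (- s)) integrable_on {0..}"
    using Gamma_integral_real[OF \<open>a > 0\<close>]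
    by (auto simp: exp_minus divide_inverse integrable_on_def)
  then have "(\<lambda>s. s powr (a - 1) * exp (- s)) integrable_on {0..z + 1}"
    by (rule integrable_on_subinterval) auto
  moreover have "isCont (\<lambda>s. s powr (a - 1) * exp (- s)) z"
    using assms by (auto intro!: continuous_intros)
  ultimately have "((\<lambda>u. integral {0..u} (\<lambda>s. s powr (a - 1) * exp (- s)))
      has_real_derivative z powr (a - 1) * exp (- z)) (at z)"
    using assms by (intro integral_has_real_derivative_at[where b = "z + 1"]) auto
  then show ?thesis
    by (simp add: lower_gamma_def[abs_def])
qed

lemma E1_has_real_derivative:
  assumes "r > 0"
  shows "(E1 d \<epsilon> K has_real_derivative
    c_dim d * \<epsilon> powr (- (real d / 2)) * (f_E1 \<epsilon> K r * r ^ (d - 1))) (at r)"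
proof -
  have cont: "continuous_on UNIV (\<lambda>r. f_E1 \<epsilon> K r * r ^ (d - 1))"
    unfolding f_E1_def divide_inverse by (intro continuous_intros)
  have "(\<lambda>r. f_E1 \<epsilon> K r * r ^ (d - 1)) integrable_on {0..r + 1}"
    by (rule integrable_continuous_real) (rule continuous_on_subset[OF cont], simp)
  moreover have "isCont (\<lambda>r. f_E1 \<epsilon> K r * r ^ (d - 1)) r"
    using cont by (simp add: continuous_on_eq_continuous_at)
  ultimately have "((\<lambda>u. integral {0..u} (\<lambda>r. f_E1 \<epsilon> K r * r ^ (d - 1)))
      has_real_derivative f_E1 \<epsilon> K r * r ^ (d - 1)) (at r)"
    using assms by (intro integral_has_real_derivative_at[where b = "r + 1"]) auto
  then show ?thesis
    unfolding E1_def[abs_def] by (rule DERIV_cmult)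
qed

text \<open>Chain rule through z = \<delta> r^2 / (2 \<epsilon>), where the 2 comes from
  \<open>Xi\<close> halving its argument. The prefactor of \<open>E2\<close> absorbs every power of
  \<delta>, so \<delta> survives only in the exponential.\<close>

lemma E2_has_real_derivative:
  assumes "d \<ge> 1" and "\<epsilon> > 0" and "\<delta> > 0" and "r > 0"
  shows "(E2 d \<epsilon> \<delta> has_real_derivative
    - (c_dim d * \<epsilon> powr (- (real d / 2)) * (exp (- (\<delta> * r\<^sup>2 / (2 * \<epsilon>))) * r ^ (d - 1)))) (at r)"
proof -
  define a where "a = real d / 2"
  define z where "z = \<delta> * r\<^sup>2 / (2 * \<epsilon>)"
  have "a > 0" "z > 0"
    using assms by (auto simp: a_def z_def)
  have "((\<lambda>r. \<delta> * r\<^sup>2 / (2 * \<epsilon>)) has_real_derivative \<delta> * r / \<epsilon>) (at r)"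
    using assms by (auto intro!: derivative_eq_intros simp: field_simps)
  with lower_gamma_has_real_derivative[OF \<open>a > 0\<close> \<open>z > 0\<close>]
  have "((\<lambda>r. lower_gamma a (\<delta> * r\<^sup>2 / (2 * \<epsilon>))) has_real_derivative
      z powr (a - 1) * exp (- z) * (\<delta> * r / \<epsilon>)) (at r)"
    unfolding z_def by (rule DERIV_chain2)
  then have deriv: "((\<lambda>r. \<delta> powr (- a) * (1 - lower_gamma a (\<delta> * r\<^sup>2 / (2 * \<epsilon>)) / Gamma a))
      has_real_derivative
      \<delta> powr (- a) * (0 - z powr (a - 1) * exp (- z) * (\<delta> * r / \<epsilon>) / Gamma a)) (at r)"
    by (intro DERIV_cmult DERIV_diff DERIV_const DERIV_cdivide)
  have E2: "(\<lambda>r. \<delta> powr (- a) * (1 - lower_gamma a (\<delta> * r\<^sup>2 / (2 * \<epsilon>)) / Gamma a))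
      = E2 d \<epsilon> \<delta>"
    by (simp add: fun_eq_iff E2_def Xi_def a_def mult.commute)
  \<comment> \<open>The algebraic part of the derivative, without \<open>exp (- z)\<close> and
    \<open>Gamma a\<close>: \<delta> cancels, and r has exponent 2(a - 1) + 1 = d - 1.\<close>
  have key: "\<delta> powr (- a) * (z powr (a - 1) * (\<delta> * r / \<epsilon>))
      = 2 powr (1 - a) * \<epsilon> powr (- a) * r ^ (d - 1)"
  proof -
    have "r\<^sup>2 powr (a - 1) = (r powr 2) powr (a - 1)"
      using assms by simp
    also have "\<dots> = r powr (real d - 2)"
      by (simp only: powr_powr a_def) (simp add: right_diff_distrib)
    finally have "r\<^sup>2 powr (a - 1) * r = r powr (real d - 2) * r powr 1"
      using assms by simp
    \<comment> \<open>Here \<open>d \<ge> 1\<close> makes the natural-number subtraction agree with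
      the real one.\<close>
    also have "\<dots> = r powr real (d - 1)"
      using assms by (simp only: powr_add[symmetric]) (simp add: of_nat_diff)
    finally have r: "r\<^sup>2 powr (a - 1) * r = r ^ (d - 1)"
      using assms by (simp only: powr_realpow)
    have \<delta>: "\<delta> powr (- a) * \<delta> powr (a - 1) * \<delta> = 1"
      using assms by (simp add: powr_diff powr_minus)
    have \<epsilon>: "\<epsilon> powr (1 - a) / \<epsilon> = \<epsilon> powr (- a)"
      using assms by (simp add: powr_diff powr_minus divide_inverse)
    have "z powr (a - 1) = \<delta> powr (a - 1) * r\<^sup>2 powr (a - 1) * (2 powr (1 - a) * \<epsilon> powr (1 - a))"
      using assms powr_minus_divide[of "2 * \<epsilon>" "a - 1"]
      by (simp add: z_def powr_divide powr_mult)
    then have "\<delta> powr (- a) * (z powr (a - 1) * (\<delta> * r / \<epsilon>)) =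
        (\<delta> powr (- a) * \<delta> powr (a - 1) * \<delta>) * (2 powr (1 - a) * (\<epsilon> powr (1 - a) / \<epsilon>))
        * (r\<^sup>2 powr (a - 1) * r)"
      by simp
    then show ?thesis
      unfolding r \<delta> \<epsilon> by simp
  qed
  have "\<delta> powr (- a) * (0 - z powr (a - 1) * exp (- z) * (\<delta> * r / \<epsilon>) / Gamma a) =
      - (\<delta> powr (- a) * (z powr (a - 1) * (\<delta> * r / \<epsilon>)) * exp (- z) / Gamma a)"
    by simp
  also have "\<dots> = - (c_dim d * \<epsilon> powr (- a) * (exp (- z) * r ^ (d - 1)))"
    unfolding key by (simp add: c_dim_def a_def)
  finally show ?thesis
    using deriv E2 by (simp only: a_def z_def)
qed

theorem proposition3p13:
  fixes d :: nat and \<epsilon> K \<delta> r0 :: real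
  assumes "d \<ge> 1" and "\<epsilon> > 0" and "K > 0" and "0 < \<delta>" and "\<delta> \<le> 1"
    and "r0 \<ge> 0"
    and "\<forall>r\<ge>0. E1 d \<epsilon> K r0 + E2 d \<epsilon> \<delta> r0 \<le> E1 d \<epsilon> K r + E2 d \<epsilon> \<delta> r"
  shows "r0 = 0 \<or>
    exp ((1 + \<epsilon>) * K / (6 * \<epsilon>) * r0 ^ 3) - 1 - exp ((1 - \<delta>) / (2 * \<epsilon>) * r0\<^sup>2) = 0"
proof (cases "r0 = 0")
  case False
  with assms have "r0 > 0" by simp
  define C where "C = c_dim d * \<epsilon> powr (- (real d / 2))"
  have "C > 0"
    using assms by (simp add: C_def c_dim_def)
  have "((\<lambda>r. E1 d \<epsilon> K r + E2 d \<epsilon> \<delta> r) has_real_derivative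
      C * (f_E1 \<epsilon> K r0 * r0 ^ (d - 1)) +
      - (C * (exp (- (\<delta> * r0\<^sup>2 / (2 * \<epsilon>))) * r0 ^ (d - 1)))) (at r0)"
    unfolding C_def using assms \<open>r0 > 0\<close>
    by (intro DERIV_add E1_has_real_derivative E2_has_real_derivative)
  \<comment> \<open>The neighbourhood of radius \<open>r0\<close> around \<open>r0\<close> contains
    only positive points, so minimality over the half-line applies on all of it.\<close>
  from DERIV_local_min[OF this \<open>r0 > 0\<close>] assms(7)
  have "C * (f_E1 \<epsilon> K r0 * r0 ^ (d - 1)) +
      - (C * (exp (- (\<delta> * r0\<^sup>2 / (2 * \<epsilon>))) * r0 ^ (d - 1))) = 0"
    by auto
  then have "f_E1 \<epsilon> K r0 = exp (- (\<delta> * r0\<^sup>2 / (2 * \<epsilon>)))"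
    using \<open>C > 0\<close> \<open>r0 > 0\<close> by simp
  \<comment> \<open>Splitting off the Gaussian factor of \<open>f_E1\<close> lets it cancel from
    both sides.\<close>
  moreover have "exp (- (\<delta> * r0\<^sup>2 / (2 * \<epsilon>)))
      = exp ((1 - \<delta>) / (2 * \<epsilon>) * r0\<^sup>2) * exp (- (1 / (2 * \<epsilon>)) * r0\<^sup>2)"
    unfolding exp_add[symmetric] by (simp add: diff_divide_distrib algebra_simps)
  ultimately show ?thesis
    by (simp add: f_E1_def)
qed simp

end
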